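(* Let $\Omega\subset\mathbb{R}^d$, $\Sigma\subset\mathbb{R}$, $\tilde\Omega=\Omega\times\Sigma\subset\mathbb{R}^{d+1}$, let $\bar f:\Omega\to\Sigma$ be a scaling function, and let $\kappa_{\bar f}:\Omega\times\Omega\to\mathbb{R}$ be the variably scaled kernel corresponding to a strictly positive definite and symmetric kernel $\kappa:\tilde\Omega\times\tilde\Omega\to\mathbb{R}$. Let $\boldsymbol{x}_1,\dots,\boldsymbol{x}_n\in\Omega$ be distinct points, let $f:\Omega\to\mathbb{R}$ be a function, and let $P_f^{\bar f}:\Omega\to\mathbb{R}$ and $P_{\bar f}^{\bar f}:\Omega\to\mathbb{R}$ be the variably scaled kernel interpolants (with kernel $\kappa_{\bar f}$) of $f$ and of $\bar f$, respectively, at the nodes $\boldsymbol{x}_1,\dots,\boldsymbol{x}_n$. Then for every $\boldsymbol{x}\in\Omega$, $$\left|\left(f-P_f^{\bar f}\right)(\boldsymbol{x})\right|\le\left|\left(f-P_{\bar f}^{\bar f}\right)(\boldsymbol{x})\right|+\|\boldsymbol{f}-\bar{\boldsymbol{f}}\|_\infty\,\lambda_{\bar f}(\boldsymbol{x}),$$ where $\lambda_{\bar f}(\boldsymbol{x})=\sum_{j=1}^n|\varphi_j^{\bar f}(\boldsymbol{x})|$ is the Lebesgue function, $\varphi_1^{\bar f},\dots,\varphi_n^{\bar f}$ are the Lagrange (cardinal) functions, and $\boldsymbol{f}-\bar{\boldsymbol{f}}=(f(\boldsymbol{x}_1)-\bar f(\boldsymbol{x}_1),\dots,f(\boldsymbol{x}_n)-\bar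 f(\boldsymbol{x}_n))^{\intercal}$.
   Context: Variably scaled kernel (VSK): given a continuous radial positive definite kernel $\kappa:\tilde\Omega\times\tilde\Omega\to\mathbb{R}$ with $\tilde\Omega=\Omega\times\Sigma$, and a scaling function $\bar f:\Omega\to\Sigma$ (not assumed continuous), the VSK is $\kappa_{\bar f}(\boldsymbol{x},\boldsymbol{z})=\kappa\big((\boldsymbol{x},\bar f(\boldsymbol{x})),(\boldsymbol{z},\bar f(\boldsymbol{z}))\big)$ for $\boldsymbol{x},\boldsymbol{z}\in\Omega$. Strictly positive definite means that for any finite set of distinct points of $\tilde\Omega$ the corresponding kernel matrix is positive definite. Collocation matrix: $\mathsf{K}_{\bar f}\in\mathbb{R}^{n\times n}$ with entries $(\mathsf{K}_{\bar f})_{ik}=\kappa_{\bar f}(\boldsymbol{x}_i,\boldsymbol{x}_k)$. VSK interpolant: for a function $g:\Omega\to\mathbb{R}$, $P_g^{\bar f}(\boldsymbol{x})=\sum_{k=1}^n c_k\,\kappa_{\bar f}(\boldsymbol{x},\boldsymbol{x}_k)$, where $\boldsymbol{c}=(c_1,\dots,c_n)^{\intercal}$ solves $\mathsf{K}_{\bar f}\boldsymbol{c}=(g(\boldsymbol{x}_1),\dots,g(\boldsymbol{x}_n))^{\intercal}$; thus $P_g^{\bar f}(\boldsymbol{x}_i)=g(\boldsymbol{x}_i)$ for all $i$. Lagrange (cardinal) functions: $\varphi_j^{\bar f}\in\mathrm{span}\{\kappa_{\bar f}(\cdot,\boldsymbol{x}_i):i=1,\dots,n\}$, defined for each $\boldsymbol{x}\in\Omega$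 by the linear system $\mathsf{K}_{\bar f}\,(\varphi_1^{\bar f}(\boldsymbol{x}),\dots,\varphi_n^{\bar f}(\boldsymbol{x}))^{\intercal}=(\kappa_{\bar f}(\boldsymbol{x},\boldsymbol{x}_1),\dots,\kappa_{\bar f}(\boldsymbol{x},\boldsymbol{x}_n))^{\intercal}$, so that $P_g^{\bar f}(\boldsymbol{x})=\sum_{j=1}^n g(\boldsymbol{x}_j)\varphi_j^{\bar f}(\boldsymbol{x})$. $\|\cdot\|_\infty$ is the maximum norm on $\mathbb{R}^n$. *)

theory Defs
  imports "HOL-Analysis.Analysis"
begin

text \<open>Kernels are total functions; only their values on the carrier set \<open>S\<close> matter. The
  coefficients of a vector are indexed by the points of the finite set \<open>X\<close> themselves, so the
  double sum is the quadratic form of the kernel matrix of \<open>X\<close>.\<close>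

definition strictly_pos_def_kernel_on :: "'p set \<Rightarrow> ('p \<Rightarrow> 'p \<Rightarrow> real) \<Rightarrow> bool" where
  "strictly_pos_def_kernel_on S \<kappa> \<longleftrightarrow>
     (\<forall>X c. finite X \<longrightarrow> X \<subseteq> S \<longrightarrow> (\<exists>p\<in>X. c p \<noteq> 0) \<longrightarrow>
        (\<Sum>p\<in>X. \<Sum>q\<in>X. c p * \<kappa> p q * c q) > 0)"

definition symmetric_kernel_on :: "'p set \<Rightarrow> ('p \<Rightarrow> 'p \<Rightarrow> real) \<Rightarrow> bool" where
  "symmetric_kernel_on S \<kappa> \<longleftrightarrow> (\<forall>p\<in>S. \<forall>q\<in>S. \<kappa> p q = \<kappa> q p)"

definition vsk :: "('a \<times> real \<Rightarrow> 'a \<times> real \<Rightarrow> real) \<Rightarrow> ('a \<Rightarrow> real) \<Rightarrow> 'a \<Rightarrow> 'a \<Rightarrow> real" where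
  "vsk \<kappa> fbar x z = \<kappa> (x, fbar x) (z, fbar z)"

definition collocation_matrix :: "('a \<Rightarrow> 'a \<Rightarrow> real) \<Rightarrow> ('n \<Rightarrow> 'a) \<Rightarrow> real^'n^'n::finite" where
  "collocation_matrix k xs = (\<chi> i j. k (xs i) (xs j))"

text \<open>The two descriptions below are proper when the collocation matrix is nonsingular; see
  \<open>collocation_system_ex1\<close>.\<close>

definition interp_coeffs :: "('a \<Rightarrow> 'a \<Rightarrow> real) \<Rightarrow> ('n \<Rightarrow> 'a) \<Rightarrow> ('a \<Rightarrow> real) \<Rightarrow> real^'n::finite" where
  "interp_coeffs k xs g = (THE c. collocation_matrix k xs *v c = (\<chi> i. g (xs i)))"

definition interpolant ::
    "('a \<Rightarrow> 'a \<Rightarrow> real) \<Rightarrow> ('n::finite \<Rightarrow> 'a) \<Rightarrow> ('a \<Rightarrow> real) \<Rightarrow> 'a \<Rightarrow> real" where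
  "interpolant k xs g x = (\<Sum>j\<in>UNIV. interp_coeffs k xs g $ j * k x (xs j))"

definition cardinal_fun ::
    "('a \<Rightarrow> 'a \<Rightarrow> real) \<Rightarrow> ('n::finite \<Rightarrow> 'a) \<Rightarrow> 'n \<Rightarrow> 'a \<Rightarrow> real" where
  "cardinal_fun k xs j x =
     (THE v. collocation_matrix k xs *v v = (\<chi> i. k x (xs i))) $ j"

definition lebesgue_fun :: "('a \<Rightarrow> 'a \<Rightarrow> real) \<Rightarrow> ('n::finite \<Rightarrow> 'a) \<Rightarrow> 'a \<Rightarrow> real" where
  "lebesgue_fun k xs x = (\<Sum>j\<in>UNIV. \<bar>cardinal_fun k xs j x\<bar>)"

lemma collocation_system_ex1:
  fixes xs :: "'n::finite \<Rightarrow> 'a" and b :: "real^'n"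
  assumes pd: "strictly_pos_def_kernel_on (\<Omega> \<times> \<Sigma>) \<kappa>"
    and fbar: "fbar \<in> \<Omega> \<rightarrow> \<Sigma>"
    and xs: "range xs \<subseteq> \<Omega>" "inj xs"
  shows "\<exists>!c. collocation_matrix (vsk \<kappa> fbar) xs *v c = b"
proof -
  let ?K = "collocation_matrix (vsk \<kappa> fbar) xs"
  let ?p = "\<lambda>i. (xs i, fbar (xs i))"
  have inj: "inj ?p" using xs(2) by (auto simp: inj_def)
  have kernel: "c = 0" if "?K *v c = 0" for c
  proof (rule ccontr)
    assume "c \<noteq> 0"
    then obtain i where i: "c $ i \<noteq> 0" by (auto simp: vec_eq_iff)
    define d where "d = (\<lambda>p. c $ inv ?p p)"
    have d: "d (?p j) = c $ j" for j
      unfolding d_def by (subst inv_f_f[OF inj]) (rule refl)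
    have sub: "range ?p \<subseteq> \<Omega> \<times> \<Sigma>" using xs(1) fbar by auto
    have "(\<Sum>p\<in>range ?p. \<Sum>q\<in>range ?p. d p * \<kappa> p q * d q) > 0"
    proof -
      have "finite (range ?p)" by simp
      moreover have "\<exists>p\<in>range ?p. d p \<noteq> 0"
        using d[of i] i by (intro bexI[of _ "?p i"] rangeI) simp
      ultimately show ?thesis
        using pd sub unfolding strictly_pos_def_kernel_on_def by blast
    qed
    also have "(\<Sum>p\<in>range ?p. \<Sum>q\<in>range ?p. d p * \<kappa> p q * d q) = c \<bullet> (?K *v c)"
      by (simp add: sum.reindex[OF inj] d inner_vec_def matrix_vector_mult_def
          collocation_matrix_def vsk_def sum_distrib_left mult.assoc)
    finally show False using that by simp
  qed
  then have "invertible ?K"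
    by (simp add: invertible_left_inverse matrix_left_invertible_ker)
  then have "bij ((*v) ?K)" by (simp add: invertible_eq_bij)
  then show ?thesis by (simp add: bij_iff)
qed

end

theory Submission
  imports Defs
begin

text \<open>By symmetry of the collocation matrix \<open>K\<close>, if \<open>K *v c = g\<close> and \<open>K *v v = k x\<close> then
  \<open>c \<bullet> (K *v v) = (K *v c) \<bullet> v\<close>, which is the cardinal form of the interpolant. Interpolation is
  thus linear in the data, and the error for \<open>f\<close> differs from \<open>f - P fbar\<close> by the interpolant of
  \<open>f - fbar\<close>, which the Lebesgue function controls.\<close>

lemma interpolant_eq_sum_cardinal_fun:
  fixes xs :: "'n::finite \<Rightarrow> 'a"
  assumes ex1: "\<And>b :: real^'n. \<exists>!c. collocation_matrix k xs *v c = b"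
    and sym: "\<And>i j. k (xs i) (xs j) = k (xs j) (xs i)"
  shows "interpolant k xs g x = (\<Sum>j\<in>UNIV. g (xs j) * cardinal_fun k xs j x)"
proof -
  let ?K = "collocation_matrix k xs"
  define c where "c = interp_coeffs k xs g"
  define v :: "real^'n" where "v = (\<chi> j. cardinal_fun k xs j x)"
  have c: "?K *v c = (\<chi> i. g (xs i))"
    unfolding c_def interp_coeffs_def by (rule theI') (rule ex1)
  \<comment> \<open>Every \<open>cardinal_fun k xs j x\<close> is a component of one described
    vector, so the vector they form is that solution itself.\<close>
  have "v = (THE v. ?K *v v = (\<chi> i. k x (xs i)))"
    by (simp add: v_def cardinal_fun_def vec_eq_iff)
  then have v: "?K *v v = (\<chi> i. k x (xs i))"
    using theI'[OF ex1] by simp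
  have "transpose ?K = ?K"
    by (simp add: transpose_def collocation_matrix_def vec_eq_iff sym)
  then have "c \<bullet> (?K *v v) = (?K *v c) \<bullet> v"
    by (metis dot_lmul_matrix transpose_matrix_vector)
  then show ?thesis
    \<comment> \<open>The left side becomes the kernel expansion with coefficients \<open>c\<close>,
      the right side the data paired with the cardinal values.\<close>
    by (simp add: c v) (simp add: interpolant_def c_def v_def inner_vec_def)
qed

text \<open>Hoelder's inequality for the maximum norm and the l1 norm, the latter of the cardinal
  values at \<open>x\<close>.\<close>

lemma abs_sum_cardinal_fun_le:
  fixes xs :: "'n::finite \<Rightarrow> 'a" and y :: "real^'n"
  shows "\<bar>\<Sum>j\<in>UNIV. y $ j * cardinal_fun k xs j x\<bar> \<le> infnorm y * lebesgue_fun k xs x"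
proof -
  have "\<bar>\<Sum>j\<in>UNIV. y $ j * cardinal_fun k xs j x\<bar>
      \<le> (\<Sum>j\<in>UNIV. \<bar>y $ j\<bar> * \<bar>cardinal_fun k xs j x\<bar>)"
    by (simp add: sum_abs flip: abs_mult)
  also have "\<dots> \<le> (\<Sum>j\<in>UNIV. infnorm y * \<bar>cardinal_fun k xs j x\<bar>)"
    by (intro sum_mono mult_right_mono component_le_infnorm_cart) simp
  finally show ?thesis
    by (simp add: lebesgue_fun_def sum_distrib_left)
qed

theorem proposition3p1:
  fixes \<Omega> :: "(real^'d) set" and \<Sigma> :: "real set"
    and \<kappa> :: "(real^'d) \<times> real \<Rightarrow> (real^'d) \<times> real \<Rightarrow> real"
    and fbar f :: "real^'d \<Rightarrow> real"
    and xs :: "'n::finite \<Rightarrow> real^'d"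
    and x :: "real^'d"
  assumes "strictly_pos_def_kernel_on (\<Omega> \<times> \<Sigma>) \<kappa>"
    and "symmetric_kernel_on (\<Omega> \<times> \<Sigma>) \<kappa>"
    and "fbar \<in> \<Omega> \<rightarrow> \<Sigma>"
    and "range xs \<subseteq> \<Omega>" and "inj xs"
    and "x \<in> \<Omega>"
  shows "\<bar>f x - interpolant (vsk \<kappa> fbar) xs f x\<bar>
       \<le> \<bar>f x - interpolant (vsk \<kappa> fbar) xs fbar x\<bar>
         + infnorm ((\<chi> j. f (xs j) - fbar (xs j)) :: real^'n) * lebesgue_fun (vsk \<kappa> fbar) xs x"
proof -
  let ?k = "vsk \<kappa> fbar"
  let ?y = "(\<chi> j. f (xs j) - fbar (xs j)) :: real^'n"
  have ex1: "\<exists>!c. collocation_matrix ?k xs *v c = b" for b :: "real^'n"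
    using assms by (intro collocation_system_ex1)
  \<comment> \<open>The lifted nodes \<open>(xs i, fbar (xs i))\<close> lie in
    \<open>\<Omega> \<times> \<Sigma>\<close>, where \<open>\<kappa>\<close> is symmetric.\<close>
  have sym: "?k (xs i) (xs j) = ?k (xs j) (xs i)" for i j
    using assms(2-4) by (auto simp: vsk_def symmetric_kernel_on_def Pi_iff image_subset_iff)
  have "interpolant ?k xs f x - interpolant ?k xs fbar x
      = (\<Sum>j\<in>UNIV. ?y $ j * cardinal_fun ?k xs j x)"
    by (simp add: interpolant_eq_sum_cardinal_fun[OF ex1 sym] sum_subtractf left_diff_distrib)
  \<comment> \<open>Triangle inequality through the interpolant of \<open>fbar\<close>.\<close>
  then show ?thesis
    using abs_sum_cardinal_fun_le[of ?y ?k xs x] by linarith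
qed

end
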